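(* Let $f(q)=\sum_{k=0}^{\infty}q^kp_k$ (with $p_k\in\mathbb{H}$) be a slice regular function on $\mathbb{B}$ such that $f(q)\in\Pi:=\{q\in\mathbb{H}:\mathrm{Re}(q)\leq1\}$ for all $q\in\mathbb{B}$, and suppose that $p_0\in[0,1)$. Then $$\sum_{k=0}^{\infty}|q^kp_k|+\left(\frac{1}{1+p_0}+\frac{|q|}{1-|q|}\right)\sum_{k=1}^{\infty}|q^kp_k|^2\leq1$$ holds for all $q$ with $|q|\leq R_*$, where $R_*\approx0.24683$ is the unique root in $(0,1)$ of the equation $3r^3-5r^2-3r+1=0$. The constant $R_*$ is best possible, i.e. it cannot be replaced by any larger number so that the inequality remains true for all such $f$.
   Context: $\mathbb{H}$ is the skew field of quaternions with its usual modulus $|\cdot|$ and real part $\mathrm{Re}$; $\mathbb{B}=\{q\in\mathbb{H}:|q|<1\}$. Let $\mathbb{S}=\{q\in\mathbb{H}:q^2=-1\}$ and, for $I\in\mathbb{S}$, $\mathbb{C}_I=\mathbb{R}\oplus I\mathbb{R}$ and $\mathbb{B}_I=\mathbb{B}\cap\mathbb{C}_I$. A function $f:\mathbb{B}\to\mathbb{H}$ is (left) slice regular if for every $I\in\mathbb{S}$ its restriction $f_I$ to $\mathbb{B}_I$ has continuous partial derivatives and satisfies $\frac12\left(\frac{\partial}{\partial x}+I\frac{\partial}{\partial y}\right)f_I(x+yI)=0$ for all $x+yI\in\mathbb{B}_I$. Every slice regular $f$ on $\mathbb{B}$ has a power series expansion $f(q)=\sum_{k=0}^\infty q^kp_k$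 on $\mathbb{B}$ with $p_k\in\mathbb{H}$. *)

theory Defs
  imports "HOL-Analysis.Analysis"
begin

section \<open>The skew field of quaternions\<close>

datatype quat = Quat (qRe: real) (qI: real) (qJ: real) (qK: real)

lemma quat_eq_iff:
  "x = y \<longleftrightarrow> qRe x = qRe y \<and> qI x = qI y \<and> qJ x = qJ y \<and> qK x = qK y"
  by (cases x; cases y) simp

instantiation quat :: ab_group_add
begin
definition zero_quat where "0 = Quat 0 0 0 0"
definition plus_quat where
  "x + y = Quat (qRe x + qRe y) (qI x + qI y) (qJ x + qJ y) (qK x + qK y)"
definition uminus_quat where "- x = Quat (- qRe x) (- qI x) (- qJ x) (- qK x)"
definition minus_quat where
  "x - y = Quat (qRe x - qRe y) (qI x - qI y) (qJ x - qJ y) (qK x - qK y)"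
instance
  by standard (simp_all add: zero_quat_def plus_quat_def uminus_quat_def minus_quat_def)
end

lemma quat_add_sel [simp]:
  "qRe 0 = 0" "qI 0 = 0" "qJ 0 = 0" "qK 0 = 0"
  "qRe (x + y) = qRe x + qRe y" "qI (x + y) = qI x + qI y"
  "qJ (x + y) = qJ x + qJ y" "qK (x + y) = qK x + qK y"
  "qRe (- x) = - qRe x" "qI (- x) = - qI x" "qJ (- x) = - qJ x" "qK (- x) = - qK x"
  "qRe (x - y) = qRe x - qRe y" "qI (x - y) = qI x - qI y"
  "qJ (x - y) = qJ x - qJ y" "qK (x - y) = qK x - qK y"
  by (simp_all add: zero_quat_def plus_quat_def uminus_quat_def minus_quat_def)

instantiation quat :: real_vector
begin
definition scaleR_quat where
  "r *\<^sub>R x = Quat (r * qRe x) (r * qI x) (r * qJ x) (r * qK x)"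
instance
  by standard (simp_all add: scaleR_quat_def quat_eq_iff algebra_simps)
end

lemma quat_scaleR_sel [simp]:
  "qRe (r *\<^sub>R x) = r * qRe x" "qI (r *\<^sub>R x) = r * qI x"
  "qJ (r *\<^sub>R x) = r * qJ x" "qK (r *\<^sub>R x) = r * qK x"
  by (simp_all add: scaleR_quat_def)

instantiation quat :: real_inner
begin
definition inner_quat where
  "inner x y = qRe x * qRe y + qI x * qI y + qJ x * qJ y + qK x * qK y"
definition norm_quat where
  "norm x = sqrt ((qRe x)\<^sup>2 + (qI x)\<^sup>2 + (qJ x)\<^sup>2 + (qK x)\<^sup>2)"
definition sgn_quat where "sgn (x::quat) = x /\<^sub>R norm x"
definition dist_quat where "dist (x::quat) y = norm (x - y)"
definition uniformity_quat where
  "(uniformity :: (quat \<times> quat) filter) = (INF e\<in>{0 <..}. principal {(x, y). dist x y < e})"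
definition open_quat where
  "open (U :: quat set) \<longleftrightarrow> (\<forall>x\<in>U. eventually (\<lambda>(x', y). x' = x \<longrightarrow> y \<in> U) uniformity)"

instance
proof
  fix x y z :: quat and r :: real
  show "inner x x = 0 \<longleftrightarrow> x = 0"
  proof
    assume "inner x x = 0"
    then have "(qRe x)\<^sup>2 + (qI x)\<^sup>2 + (qJ x)\<^sup>2 + (qK x)\<^sup>2 = 0"
      by (simp add: inner_quat_def power2_eq_square)
    then show "x = 0"
      by (simp add: quat_eq_iff add_nonneg_eq_0_iff)
  qed (simp add: inner_quat_def)
qed (simp_all add: quat_eq_iff inner_quat_def norm_quat_def sgn_quat_def dist_quat_def
      uniformity_quat_def open_quat_def algebra_simps power2_eq_square)

end

instantiation quat :: "{one, times}"
begin
definition one_quat where "1 = Quat 1 0 0 0"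
definition times_quat where
  "x * y = Quat
     (qRe x * qRe y - qI x * qI y - qJ x * qJ y - qK x * qK y)
     (qRe x * qI y + qI x * qRe y + qJ x * qK y - qK x * qJ y)
     (qRe x * qJ y - qI x * qK y + qJ x * qRe y + qK x * qI y)
     (qRe x * qK y + qI x * qJ y - qJ x * qI y + qK x * qRe y)"
instance ..
end

lemma quat_mult_sel [simp]:
  "qRe 1 = 1" "qI 1 = 0" "qJ 1 = 0" "qK 1 = 0"
  "qRe (x * y) = qRe x * qRe y - qI x * qI y - qJ x * qJ y - qK x * qK y"
  "qI (x * y) = qRe x * qI y + qI x * qRe y + qJ x * qK y - qK x * qJ y"
  "qJ (x * y) = qRe x * qJ y - qI x * qK y + qJ x * qRe y + qK x * qI y"
  "qK (x * y) = qRe x * qK y + qI x * qJ y - qJ x * qI y + qK x * qRe y"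
  by (simp_all add: one_quat_def times_quat_def)

instance quat :: real_algebra_1
  by standard (simp_all add: quat_eq_iff algebra_simps)

lemma quat_norm_sq: "(norm (x::quat))\<^sup>2 = (qRe x)\<^sup>2 + (qI x)\<^sup>2 + (qJ x)\<^sup>2 + (qK x)\<^sup>2"
  by (simp add: norm_quat_def)

lemma quat_conj_mult:
  "Quat (qRe x) (- qI x) (- qJ x) (- qK x) * x = (norm x)\<^sup>2 *\<^sub>R 1"
  "x * Quat (qRe x) (- qI x) (- qJ x) (- qK x) = (norm x)\<^sup>2 *\<^sub>R 1"
  by (simp_all add: quat_eq_iff quat_norm_sq) (simp_all add: power2_eq_square)

instantiation quat :: inverse
begin
definition inverse_quat where
  "inverse x = Quat (qRe x) (- qI x) (- qJ x) (- qK x) /\<^sub>R (norm x)\<^sup>2"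
definition divide_quat where
  "(x::quat) div y = x * (Quat (qRe y) (- qI y) (- qJ y) (- qK y) /\<^sub>R (norm y)\<^sup>2)"
instance ..
end

lemma quat_norm_mult: "norm (x * y) = norm x * norm (y::quat)"
proof (rule power2_eq_imp_eq)
  show "(norm (x * y))\<^sup>2 = (norm x * norm y)\<^sup>2"
    unfolding power_mult_distrib quat_norm_sq quat_mult_sel
    by (simp add: power2_eq_square algebra_simps)
qed simp_all

instance quat :: real_normed_div_algebra
proof
  fix x y :: quat
  show "inverse x * x = 1" "x * inverse x = 1" if "x \<noteq> 0"
    using that by (simp_all add: inverse_quat_def quat_conj_mult)
  show "inverse (0::quat) = 0" by (simp add: inverse_quat_def quat_eq_iff)
  show "x / y = x * inverse y" by (simp add: divide_quat_def inverse_quat_def)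
qed (rule quat_norm_mult)

lemma quat_units:
  "Quat 0 1 0 0 * Quat 0 0 1 0 = Quat 0 0 0 1" "Quat 0 0 1 0 * Quat 0 0 0 1 = Quat 0 1 0 0"
  "Quat 0 0 0 1 * Quat 0 1 0 0 = Quat 0 0 1 0" "Quat 0 1 0 0 * Quat 0 1 0 0 = - 1"
  "Quat 0 0 1 0 * Quat 0 0 1 0 = - 1" "Quat 0 0 0 1 * Quat 0 0 0 1 = - 1"
  by (simp_all add: quat_eq_iff)

instantiation quat :: euclidean_space
begin
definition Basis_quat where
  "Basis = {Quat 1 0 0 0, Quat 0 1 0 0, Quat 0 0 1 0, Quat 0 0 0 1}"
instance
proof
  fix x u v :: quat
  show "inner u v = (if u = v then 1 else 0)" if "u \<in> Basis" "v \<in> Basis"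
    using that unfolding Basis_quat_def by (elim insertE emptyE) (simp_all add: inner_quat_def)
  show "(\<forall>u\<in>Basis. inner x u = 0) \<longleftrightarrow> x = 0"
    by (simp add: Basis_quat_def inner_quat_def quat_eq_iff [of x])
qed (simp_all add: Basis_quat_def)
end

section \<open>Slice regular functions on the unit ball\<close>

text \<open>Functions on the unit ball \<^term>\<open>ball 0 1 :: quat set\<close> are represented by total functions;
  their values off the ball are never used.\<close>

definition imag_units :: "quat set" where
  "imag_units = {I. I\<^sup>2 = - 1}"

text \<open>The coordinates \<open>(x, y)\<close> of the points \<open>x + y I\<close> of the slice of the ball through \<open>I\<close>.\<close>

definition slice_disc :: "quat \<Rightarrow> (real \<times> real) set" where
  "slice_disc I = {(x, y). of_real x + y *\<^sub>R I \<in> ball 0 1}"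

definition slice_regular :: "(quat \<Rightarrow> quat) \<Rightarrow> bool" where
  "slice_regular f \<longleftrightarrow> (\<forall>I\<in>imag_units. \<exists>fx fy :: real \<times> real \<Rightarrow> quat.
     continuous_on (slice_disc I) fx \<and> continuous_on (slice_disc I) fy \<and>
     (\<forall>(x, y)\<in>slice_disc I.
        ((\<lambda>t. f (of_real t + y *\<^sub>R I)) has_vector_derivative fx (x, y)) (at x) \<and>
        ((\<lambda>t. f (of_real x + t *\<^sub>R I)) has_vector_derivative fy (x, y)) (at y) \<and>
        (1/2) *\<^sub>R (fx (x, y) + I * fy (x, y)) = 0))"

section \<open>The function class and the Bohr-type sum\<close>

definition half_space :: "quat set" where
  "half_space = {q. qRe q \<le> 1}"

definition bohr_class :: "(quat \<Rightarrow> quat) \<Rightarrow> (nat \<Rightarrow> quat) \<Rightarrow> bool" where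
  "bohr_class f p \<longleftrightarrow>
     slice_regular f \<and>
     (\<forall>q\<in>ball 0 1. (\<lambda>k. q ^ k * p k) sums f q) \<and>
     (\<forall>q\<in>ball 0 1. f q \<in> half_space) \<and>
     p 0 \<in> of_real ` {0..<1}"

text \<open>Both series occurring in the inequality converge; \<^const>\<open>suminf\<close> is meaningful only then.\<close>

definition bohr_summable :: "(nat \<Rightarrow> quat) \<Rightarrow> quat \<Rightarrow> bool" where
  "bohr_summable p q \<longleftrightarrow>
     summable (\<lambda>k. norm (q ^ k * p k)) \<and> summable (\<lambda>k. (norm (q ^ Suc k * p (Suc k)))\<^sup>2)"

text \<open>Since \<open>p 0\<close> is a real quaternion in the function class, it enters the real expression
  \<open>1 / (1 + p 0)\<close> through its real part. The second series starts at index 1.\<close>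

definition bohr_sum :: "(nat \<Rightarrow> quat) \<Rightarrow> quat \<Rightarrow> real" where
  "bohr_sum p q =
     (\<Sum>k. norm (q ^ k * p k)) +
     (1 / (1 + qRe (p 0)) + norm q / (1 - norm q)) * (\<Sum>k. (norm (q ^ Suc k * p (Suc k)))\<^sup>2)"

end

theory Submission
  imports Defs
begin

text \<open>Since \<open>Re f \<le> 1\<close>, a Caratheodory-type estimate gives \<open>|p\<^sub>n| \<le> 2 (1 - p\<^sub>0)\<close> for
  \<open>n \<ge> 1\<close>. Inserting it, all sums become geometric, and \<open>1\<close> minus the resulting bound is
  \<open>1 - p\<^sub>0\<close> times an expression that is smallest for \<open>p\<^sub>0 = 0\<close>, where its sign is that of
  \<open>3r\<^sup>3 - 5r\<^sup>2 - 3r + 1\<close>. All estimates are equalities for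
  \<open>f(q) = 1 - (1 + q)(1 - q)\<^sup>-\<^sup>1 = - 2 (q + q\<^sup>2 + \<dots>)\<close>.\<close>

section \<open>Cosine integrals and coefficients of cosine series\<close>

lemma has_integral_cos_period:
  fixes m :: int and c :: real
  shows "((\<lambda>t. cos (of_int m * t + c)) has_integral (if m = 0 then 2 * pi * cos c else 0)) {0..2 * pi}"
proof (cases "m = 0")
  case True
  then show ?thesis
    using has_integral_const_real [of "cos c" 0 "2 * pi"] by simp
next
  case False
  have "((\<lambda>t. cos (of_int m * t + c)) has_integral
      (sin (of_int m * (2 * pi) + c) / of_int m - sin (of_int m * 0 + c) / of_int m)) {0..2 * pi}"
    using False
    by (intro fundamental_theorem_of_calculus)
      (auto intro!: derivative_eq_intros simp flip: has_real_derivative_iff_has_vector_derivative)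
  moreover have "sin (of_int m * (2 * pi) + c) = sin c"
    using sin_int_2pin [of m] cos_int_2pin [of m] by (simp add: sin_add mult.commute mult.left_commute)
  ultimately show ?thesis
    using False by simp
qed

text \<open>Product-to-sum formulas leave cosines of frequencies \<open>k\<close>,
  \<open>k - n\<close> (possibly negative, hence the integer frequency above) and
  \<open>k + n\<close>. A full period kills every nonzero frequency, and \<open>k + n\<close> is
  never 0 because \<open>n > 0\<close>.\<close>

lemma has_integral_cos_times_cos:
  fixes k n :: nat and b c :: real
  assumes "n > 0"
  shows "((\<lambda>t. cos (real k * t + b) * (1 + cos (real n * t + c))) has_integral
    ((if k = 0 then 2 * pi * cos b else 0) + (if k = n then pi * cos (b - c) else 0))) {0..2 * pi}"
proof -
  have eq: "cos (real k * t + b) * (1 + cos (real n * t + c)) =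
      cos (of_int (int k) * t + b) + (1/2) * (cos (of_int (int k - int n) * t + (b - c))
       + cos (of_int (int k + int n) * t + (b + c)))" for t
  proof -
    have *: "of_int (int k - int n) * t + (b - c) = (real k * t + b) - (real n * t + c)"
      "of_int (int k + int n) * t + (b + c) = (real k * t + b) + (real n * t + c)"
      by (simp_all add: algebra_simps)
    show ?thesis unfolding * cos_add cos_diff by (simp add: algebra_simps)
  qed
  show ?thesis
    unfolding eq
    by (rule has_integral_eq_rhs, (rule has_integral_add has_integral_mult_right has_integral_cos_period)+)
      (use assms in auto)
qed

text \<open>Integrate the nonnegative function \<open>M - h(t)\<close> against the nonnegative weight
  \<open>1 + cos (n t + \<phi>\<^sub>n)\<close>. Majorizing the partial sums by \<open>M\<close> plus a tail
  avoids exchanging sum and integral.\<close>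

lemma cos_series_coeff_bound:
  fixes \<rho> \<phi> :: "nat \<Rightarrow> real"
  assumes summ: "summable (\<lambda>k. \<bar>\<rho> k\<bar>)"
    and bound: "\<And>t. (\<Sum>k. \<rho> k * cos (real k * t + \<phi> k)) \<le> M"
    and "n > 0"
  shows "\<rho> n \<le> 2 * (M - \<rho> 0 * cos (\<phi> 0))"
proof -
  define T where "T N = (\<Sum>k. \<bar>\<rho> (k + N)\<bar>)" for N
  have T: "T \<longlonglongrightarrow> 0"
    unfolding T_def by (rule suminf_exist_split2) (use summ in simp)
  have part: "(\<Sum>k<N. \<rho> k * cos (real k * t + \<phi> k)) \<le> M + T N" for N t
  proof -
    let ?g = "\<lambda>k. \<rho> k * cos (real k * t + \<phi> k)"
    have le: "\<bar>?g k\<bar> \<le> \<bar>\<rho> k\<bar>" for k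
      unfolding abs_mult by (rule mult_left_le) simp_all
    have sg: "summable (\<lambda>k. \<bar>?g k\<bar>)"
      by (rule summable_comparison_test' [OF summ, of 0]) (use le in simp)
    then have "suminf ?g = (\<Sum>k. ?g (k + N)) + (\<Sum>k<N. ?g k)"
      by (rule suminf_split_initial_segment [OF summable_rabs_cancel])
    moreover have "\<bar>\<Sum>k. ?g (k + N)\<bar> \<le> (\<Sum>k. \<bar>?g (k + N)\<bar>)"
      using summable_ignore_initial_segment [OF sg, of N] by (rule summable_rabs)
    moreover have "(\<Sum>k. \<bar>?g (k + N)\<bar>) \<le> T N"
      unfolding T_def
      using summable_ignore_initial_segment [OF sg, of N]
        summable_ignore_initial_segment [OF summ, of N]
      by (intro suminf_le le)
    ultimately show ?thesis
      using bound [of t] by linarith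
  qed
  have le_tail: "\<rho> n \<le> 2 * (M + T N - \<rho> 0 * cos (\<phi> 0))" if "N > n" for N
  proof -
    \<comment> \<open>With phase \<open>\<phi> n\<close> in the weight, the term of index
      \<open>n\<close> contributes \<open>cos 0 = 1\<close>, that is, its whole amplitude, whatever
      its phase is.\<close>
    let ?w = "\<lambda>t. 1 + cos (real n * t + \<phi> n)"
    let ?I = "\<lambda>k. (if k = 0 then 2 * pi * cos (\<phi> k) else 0)
      + (if k = n then pi * cos (\<phi> k - \<phi> n) else 0)"
    have "((\<lambda>t. (M + T N) * ?w t - (\<Sum>k<N. \<rho> k * (cos (real k * t + \<phi> k) * ?w t)))
        has_integral ((M + T N) * (2 * pi) - (\<Sum>k<N. \<rho> k * ?I k))) {0..2 * pi}"
    proof (rule has_integral_diff)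
      show "((\<lambda>t. (M + T N) * ?w t) has_integral (M + T N) * (2 * pi)) {0..2 * pi}"
        \<comment> \<open>The weight alone is the case \<open>k = 0\<close>, \<open>b = 0\<close>,
          where the first cosine is constantly 1.\<close>
        using has_integral_cos_times_cos [OF \<open>n > 0\<close>, of 0 0 "\<phi> n"] \<open>n > 0\<close>
        by (intro has_integral_mult_right) simp
      show "((\<lambda>t. \<Sum>k<N. \<rho> k * (cos (real k * t + \<phi> k) * ?w t))
          has_integral (\<Sum>k<N. \<rho> k * ?I k)) {0..2 * pi}"
        by (rule has_integral_sum [OF finite_lessThan],
            rule has_integral_mult_right [OF has_integral_cos_times_cos [OF \<open>n > 0\<close>]])
    qed
    moreover have "0 \<le> (M + T N) * ?w t - (\<Sum>k<N. \<rho> k * (cos (real k * t + \<phi> k) * ?w t))" for t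
    proof -
      have "?w t \<ge> 0"
        using cos_ge_minus_one [of "real n * t + \<phi> n"] by linarith
      then have "0 \<le> (M + T N - (\<Sum>k<N. \<rho> k * cos (real k * t + \<phi> k))) * ?w t"
        using part [of t N] by (intro mult_nonneg_nonneg) auto
      then show ?thesis
        by (simp only: sum_distrib_right left_diff_distrib mult.assoc)
    qed
    ultimately have "0 \<le> (M + T N) * (2 * pi) - (\<Sum>k<N. \<rho> k * ?I k)"
      by (rule has_integral_nonneg)
    moreover have "(\<Sum>k<N. \<rho> k * ?I k) = \<rho> 0 * (2 * pi * cos (\<phi> 0)) + \<rho> n * pi"
    proof -
      have "(\<Sum>k<N. \<rho> k * ?I k) = (\<Sum>k<N. (if k = 0 then \<rho> k * (2 * pi * cos (\<phi> k)) else 0)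
          + (if k = n then \<rho> k * pi else 0))"
        using \<open>n > 0\<close> by (intro sum.cong) simp_all
      then show ?thesis
        using that by (simp add: sum.distrib)
    qed
    ultimately have "0 \<le> pi * (2 * (M + T N - \<rho> 0 * cos (\<phi> 0)) - \<rho> n)"
      using \<open>n > 0\<close> by (simp add: algebra_simps)
    then show ?thesis
      using pi_gt_zero by (simp add: zero_le_mult_iff)
  qed
  have "(\<lambda>N. 2 * (M + T N - \<rho> 0 * cos (\<phi> 0))) \<longlonglongrightarrow> 2 * (M + 0 - \<rho> 0 * cos (\<phi> 0))"
    by (intro tendsto_intros T)
  then have "\<rho> n \<le> 2 * (M + 0 - \<rho> 0 * cos (\<phi> 0))"
    by (rule LIMSEQ_le_const) (intro exI [of _ "Suc n"] allI impI le_tail Suc_le_lessD)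
  then show ?thesis
    by simp
qed

section \<open>Slices of the quaternions and the coefficient estimate\<close>

definition slice_cis :: "quat \<Rightarrow> real \<Rightarrow> quat" where
  "slice_cis I t = of_real (cos t) + sin t *\<^sub>R I"

text \<open>De Moivre's formula: for an imaginary unit \<open>I\<close>, the reals and
  \<open>I\<close> span a copy of the complex plane, in which \<open>slice_cis I t\<close> is exp(t
  I).\<close>

lemma slice_cis_power:
  assumes "I * I = - 1"
  shows "slice_cis I t ^ k = slice_cis I (real k * t)"
proof (induction k)
  case (Suc k)
  have "slice_cis I s * slice_cis I t = slice_cis I (s + t)" for s t
    using assms
    by (simp add: slice_cis_def sin_add cos_add algebra_simps of_real_def)
  then show ?case
    using Suc by (simp add: algebra_simps)
qed (simp add: slice_cis_def)

text \<open>The last property says that \<open>x\<close> lies in the slice of \<open>I\<close>,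
  since \<open>- qRe (I * x)\<close> is the component of \<open>x\<close> along \<open>I\<close>.
  The witness is the normalized imaginary part of \<open>x\<close>; if \<open>x\<close> is real, any
  imaginary unit will do.\<close>

lemma exists_slice:
  fixes x :: quat
  obtains I :: quat where "I * I = - 1" "qRe I = 0" "norm I = 1"
    "(qRe x)\<^sup>2 + (qRe (I * x))\<^sup>2 = (norm x)\<^sup>2"
proof -
  define v where "v = sqrt ((qI x)\<^sup>2 + (qJ x)\<^sup>2 + (qK x)\<^sup>2)"
  have v2: "v\<^sup>2 = (qI x)\<^sup>2 + (qJ x)\<^sup>2 + (qK x)\<^sup>2"
    unfolding v_def by simp
  show ?thesis
  proof (cases "v = 0")
    case True
    then have "qI x = 0" "qJ x = 0" "qK x = 0"
      using v2 by (simp_all add: add_nonneg_eq_0_iff)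
    then show ?thesis
      by (intro that [of "Quat 0 1 0 0"]) (simp_all add: quat_eq_iff quat_norm_sq norm_quat_def)
  next
    case False
    have v2': "qI x * qI x + qJ x * qJ x + qK x * qK x = v * v"
      using v2 by (simp add: power2_eq_square)
    have one: "(qI x / v) * (qI x / v) + (qJ x / v) * (qJ x / v) + (qK x / v) * (qK x / v) = 1"
      using False by (simp add: v2' flip: add_divide_distrib)
    have re: "qI x / v * qI x + qJ x / v * qJ x + qK x / v * qK x = v"
      using False by (simp add: v2' flip: add_divide_distrib)
    show ?thesis
    proof (rule that [of "Quat 0 (qI x / v) (qJ x / v) (qK x / v)"])
      let ?I = "Quat 0 (qI x / v) (qJ x / v) (qK x / v)"
      show "?I * ?I = - 1"
        unfolding quat_eq_iff using one by simp
      show "norm ?I = 1"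
        using one by (simp add: norm_quat_def power2_eq_square)
      have "qRe (?I * x) = - v"
        using re by simp
      then show "(qRe x)\<^sup>2 + (qRe (?I * x))\<^sup>2 = (norm x)\<^sup>2"
        by (simp add: v2 quat_norm_sq)
    qed simp
  qed
qed

lemma norm_slice_cis:
  assumes "qRe I = 0" "norm I = 1"
  shows "norm (slice_cis I t) = 1"
proof -
  have "(qI I)\<^sup>2 + (qJ I)\<^sup>2 + (qK I)\<^sup>2 = 1"
    using quat_norm_sq [of I] assms by simp
  then have "(sin t)\<^sup>2 * ((qI I)\<^sup>2 + (qJ I)\<^sup>2 + (qK I)\<^sup>2) + (cos t)\<^sup>2 = 1"
    by simp
  then show ?thesis
    using assms by (simp add: slice_cis_def norm_quat_def of_real_def power_mult_distrib algebra_simps)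
qed

text \<open>Convergence at a real point \<open>s\<close> beyond \<open>r\<close> forces absolute
  convergence at \<open>r\<close>. A real \<open>s\<close> is central, so the powers can be moved to
  the right of the coefficients, the form that \<open>powser_insidea\<close> expects.\<close>

lemma power_series_norm_summable:
  fixes p :: "nat \<Rightarrow> quat"
  assumes "\<And>q. norm q < 1 \<Longrightarrow> summable (\<lambda>k. q ^ k * p k)" "0 \<le> r" "r < 1"
  shows "summable (\<lambda>k. r ^ k * norm (p k))"
proof -
  obtain s where s: "r < s" "s < 1"
    using dense assms(3) by blast
  have "(of_real s :: quat) ^ k * p k = p k * of_real s ^ k" for k
    by (simp add: of_real_def scaleR_power)
  then have "summable (\<lambda>k. p k * (of_real s) ^ k)"
    using assms(1) [of "of_real s"] s assms(2) by simp
  then have "summable (\<lambda>k. norm (p k * (of_real r) ^ k))"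
    by (rule powser_insidea) (use s assms in simp)
  then show ?thesis
    using assms by (simp add: norm_mult norm_power mult.commute)
qed

lemma polar_coordinates:
  fixes a b :: real
  shows "\<exists>\<phi>. a = sqrt (a\<^sup>2 + b\<^sup>2) * cos \<phi> \<and> b = sqrt (a\<^sup>2 + b\<^sup>2) * sin \<phi>"
proof (cases "a\<^sup>2 + b\<^sup>2 = 0")
  case True
  then show ?thesis
    by (simp add: sum_power2_eq_zero_iff)
next
  case False
  define \<rho> where "\<rho> = sqrt (a\<^sup>2 + b\<^sup>2)"
  have \<rho>: "\<rho>\<^sup>2 = a\<^sup>2 + b\<^sup>2" "\<rho> \<noteq> 0"
    using False by (simp_all add: \<rho>_def)
  then have "(a / \<rho>)\<^sup>2 + (b / \<rho>)\<^sup>2 = 1"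
    using False by (simp add: power_divide flip: add_divide_distrib)
  then obtain \<phi> where "a / \<rho> = cos \<phi>" "b / \<rho> = sin \<phi>"
    by (metis sincos_total_2pi)
  then show ?thesis
    using \<rho>(2) unfolding \<rho>_def [symmetric] by (intro exI [of _ \<phi>]) (simp add: field_simps)
qed

lemma qRe_sums: "f sums s \<Longrightarrow> (\<lambda>k. qRe (f k)) sums qRe s"
proof -
  have "qRe x = inner x 1" for x
    by (simp add: inner_quat_def)
  then show "f sums s \<Longrightarrow> (\<lambda>k. qRe (f k)) sums qRe s"
    by (simp add: bounded_linear.sums [OF bounded_linear_inner_left])
qed

text \<open>Only the components of the coefficients along \<open>1\<close> and \<open>I\<close> contribute to the real part of
  \<open>f\<close> on the slice of \<open>I\<close>, so it suffices to work in the slice containing \<open>p n\<close>.\<close>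

lemma caratheodory_coeff_bound:
  fixes p :: "nat \<Rightarrow> quat"
  assumes sums: "\<And>q. norm q < 1 \<Longrightarrow> (\<lambda>k. q ^ k * p k) sums f q"
    and re: "\<And>q. norm q < 1 \<Longrightarrow> qRe (f q) \<le> M"
    and "n > 0"
  shows "norm (p n) \<le> 2 * (M - qRe (p 0))"
proof -
  obtain I where I: "I * I = - 1" "qRe I = 0" "norm I = 1"
    "(qRe (p n))\<^sup>2 + (qRe (I * p n))\<^sup>2 = (norm (p n))\<^sup>2"
    by (rule exists_slice)
  \<comment> \<open>\<open>\<rho> k\<close> and the angle \<open>\<phi> k\<close> below are polar
    coordinates, in the slice of \<open>I\<close>, of the orthogonal projection of
    \<open>p k\<close> to that slice.\<close>
  define \<rho> where "\<rho> k = sqrt ((qRe (p k))\<^sup>2 + (qRe (I * p k))\<^sup>2)" for k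
  have "\<exists>\<phi>. qRe (p k) = \<rho> k * cos \<phi> \<and> - qRe (I * p k) = \<rho> k * sin \<phi>" for k
    using polar_coordinates [of "qRe (p k)" "- qRe (I * p k)"]
    unfolding \<rho>_def power2_minus by metis
  then obtain \<phi> where \<phi>: "\<And>k. qRe (p k) = \<rho> k * cos (\<phi> k)" "\<And>k. - qRe (I * p k) = \<rho> k * sin (\<phi> k)"
    by metis
  \<comment> \<open>The crude factor 2 is harmless: the bound only serves summability.\<close>
  have \<rho>_le: "\<rho> k \<le> 2 * norm (p k)" for k
  proof -
    have "\<bar>qRe x\<bar> \<le> norm x" for x :: quat
      unfolding norm_quat_def by (intro real_le_rsqrt) simp
    from this [of "p k"] this [of "I * p k"] I(3)
    show ?thesis
      unfolding \<rho>_def using sqrt_sum_squares_le_sum_abs [of "qRe (p k)" "qRe (I * p k)"]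
      by (simp only: norm_mult)
  qed
  have \<rho>_nonneg: "\<rho> k \<ge> 0" for k
    by (simp add: \<rho>_def)
  \<comment> \<open>On a circle of radius \<open>r < 1\<close> the series converges absolutely;
    \<open>r\<close> tends to 1 at the end.\<close>
  have main: "r ^ n * norm (p n) \<le> 2 * (M - qRe (p 0))" if r: "0 < r" "r < 1" for r
  proof -
    have "summable (\<lambda>k. 2 * (r ^ k * norm (p k)))"
      by (intro summable_mult power_series_norm_summable) (use sums r in \<open>auto simp: sums_iff\<close>)
    then have "summable (\<lambda>k. \<bar>r ^ k * \<rho> k\<bar>)"
      by (rule summable_comparison_test' [where N = 0])
        (use r \<rho>_le \<rho>_nonneg in \<open>simp add: abs_mult mult.left_commute\<close>)
    moreover have "(\<Sum>k. r ^ k * \<rho> k * cos (real k * t + \<phi> k)) \<le> M" for t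
    proof -
      let ?q = "r *\<^sub>R slice_cis I t"
      have q: "norm ?q < 1"
        using r I by (simp add: norm_slice_cis)
      have "qRe (?q ^ k * p k) = r ^ k * \<rho> k * cos (real k * t + \<phi> k)" for k
      proof -
        have "?q ^ k * p k = r ^ k *\<^sub>R (cos (real k * t) *\<^sub>R p k + sin (real k * t) *\<^sub>R (I * p k))"
          using I by (simp add: scaleR_power slice_cis_power)
            (simp add: slice_cis_def of_real_def algebra_simps)
        then have "qRe (?q ^ k * p k) = r ^ k * (cos (real k * t) * qRe (p k) - sin (real k * t) * (- qRe (I * p k)))"
          by (simp only: quat_scaleR_sel quat_add_sel mult_minus_right diff_minus_eq_add)
        then show ?thesis
          unfolding \<phi> by (simp add: cos_add algebra_simps)
      qed
      then have "(\<lambda>k. r ^ k * \<rho> k * cos (real k * t + \<phi> k)) sums qRe (f ?q)"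
        using qRe_sums [OF sums [OF q]] by (simp only:)
      then show ?thesis
        using re [OF q] by (simp add: sums_iff)
    qed
    ultimately have "r ^ n * \<rho> n \<le> 2 * (M - r ^ 0 * \<rho> 0 * cos (\<phi> 0))"
      using \<open>n > 0\<close> by (rule cos_series_coeff_bound)
    \<comment> \<open>The choice of \<open>I\<close> enters here: projecting \<open>p n\<close> to
      the slice loses nothing.\<close>
    moreover have "\<rho> n = norm (p n)"
      by (simp only: \<rho>_def I(4) real_sqrt_abs abs_norm_cancel)
    ultimately show ?thesis
      using \<phi>(1) [of 0] by simp
  qed
  have "((\<lambda>r. r ^ n * norm (p n)) \<longlongrightarrow> 1 ^ n * norm (p n)) (at_left (1::real))"
    by (intro tendsto_intros)
  moreover have "\<forall>\<^sub>F r in at_left (1::real). r ^ n * norm (p n) \<le> 2 * (M - qRe (p 0))"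
    using eventually_at_left_real [of 0 "1::real"] by (rule eventually_mono) (use main in auto)
  ultimately show ?thesis
    using tendsto_upperbound by fastforce
qed

section \<open>The cubic and the Bohr-type inequality\<close>

lemma bohr_poly_strict_antimono:
  fixes x y :: real
  assumes "0 \<le> x" "x < y" "y \<le> 1"
  shows "3 * y ^ 3 - 5 * y ^ 2 - 3 * y + 1 < 3 * x ^ 3 - 5 * x ^ 2 - 3 * x + 1"
proof -
  have "x * x \<le> x" "y * y \<le> y"
    using assms by (simp_all only: mult_left_le)
  moreover have "2 * (x * y) \<le> x * x + y * y"
    using zero_le_power2 [of "x - y"] by (simp add: power2_eq_square algebra_simps)
  \<comment> \<open>This is the difference quotient of the cubic. The three bounds give 3(x^2 + xy +
    y^2) <= 9/2 (x + y), which is less than 5(x + y) + 3.\<close>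
  ultimately have "3 * (x * x + x * y + y * y) - 5 * (x + y) - 3 < 0"
    using assms by (simp only: right_diff_distrib distrib_left)
  then have "(y - x) * (3 * (x * x + x * y + y * y) - 5 * (x + y) - 3) < 0"
    using assms by (simp add: mult_pos_neg)
  then show ?thesis
    by (simp add: power2_eq_square power3_eq_cube algebra_simps)
qed

text \<open>The left side is the excess over 1 both of the general bound at \<open>p 0 = 0\<close>
  and of the extremal sum at a real point, so one sign, that of the cubic, decides the inequality
  and its sharpness.\<close>

lemma bohr_poly_identity:
  fixes r :: real
  assumes "0 \<le> r" "r < 1"
  shows "2 * (r / (1 - r)) + (1 + r / (1 - r)) * (4 * (r\<^sup>2 / (1 - r\<^sup>2))) - 1
    = - (3 * r ^ 3 - 5 * r ^ 2 - 3 * r + 1) / ((1 - r) * (1 - r\<^sup>2))"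
proof -
  have "r\<^sup>2 < 1"
    using assms by (simp add: power_less_one_iff)
  then have "1 - r \<noteq> 0" "1 - r\<^sup>2 \<noteq> 0"
    using assms by auto
  then show ?thesis
    by (simp add: divide_simps) (simp add: power2_eq_square power3_eq_cube algebra_simps)
qed

lemma geometric_Suc_sums:
  fixes r :: real
  assumes "0 \<le> r" "r < 1"
  shows "(\<lambda>k. r ^ Suc k) sums (r / (1 - r))"
  using sums_mult [OF geometric_sums [of r], of r] assms by simp

lemma geometric_square_Suc_sums:
  fixes r :: real
  assumes "0 \<le> r" "r < 1"
  shows "(\<lambda>k. (r ^ Suc k)\<^sup>2) sums (r\<^sup>2 / (1 - r\<^sup>2))"
proof -
  have "(r\<^sup>2) ^ Suc k = (r ^ Suc k)\<^sup>2" for k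
    by (metis power_mult mult.commute)
  then show ?thesis
    using geometric_Suc_sums [of "r\<^sup>2"] assms by (simp add: power_less_one_iff)
qed

text \<open>The radius enters only through the sign of the cubic, so the root need not be located
  here.\<close>

lemma bohr_inequality:
  assumes cls: "bohr_class f p" and "norm q < 1"
    and poly: "3 * norm q ^ 3 - 5 * norm q ^ 2 - 3 * norm q + 1 \<ge> 0"
  shows "bohr_summable p q \<and> bohr_sum p q \<le> 1"
proof -
  define r where "r = norm q"
  have r: "0 \<le> r" "r < 1"
    using assms by (simp_all add: r_def)
  obtain a where a: "p 0 = of_real a" "0 \<le> a" "a < 1"
    using cls unfolding bohr_class_def by auto
  have coeff: "norm (p n) \<le> 2 * (1 - a)" if "n > 0" for n
    using caratheodory_coeff_bound [of p f 1 n] cls that a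
    by (auto simp: bohr_class_def half_space_def of_real_def)
  have coeff_term: "norm (q ^ Suc k * p (Suc k)) \<le> 2 * (1 - a) * r ^ Suc k" for k
  proof -
    have "r ^ Suc k * norm (p (Suc k)) \<le> r ^ Suc k * (2 * (1 - a))"
      using r coeff [of "Suc k"] by (intro mult_left_mono) simp_all
    then show ?thesis
      unfolding norm_mult norm_power r_def by (simp add: mult_ac)
  qed
  have sq: "(norm (q ^ Suc k * p (Suc k)))\<^sup>2 \<le> (2 * (1 - a))\<^sup>2 * (r ^ Suc k)\<^sup>2" for k
    using power_mono [OF coeff_term norm_ge_zero, of k 2] by (simp only: power_mult_distrib)
  have S1: "(\<lambda>k. 2 * (1 - a) * r ^ Suc k) sums (2 * (1 - a) * (r / (1 - r)))"
    using r by (intro sums_mult geometric_Suc_sums)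
  have S2: "(\<lambda>k. (2 * (1 - a))\<^sup>2 * (r ^ Suc k)\<^sup>2) sums ((2 * (1 - a))\<^sup>2 * (r\<^sup>2 / (1 - r\<^sup>2)))"
    using r by (intro sums_mult geometric_square_Suc_sums)
  have s1: "summable (\<lambda>k. norm (q ^ Suc k * p (Suc k)))"
    by (rule summable_comparison_test' [OF sums_summable [OF S1], of 0])
      (use coeff_term in \<open>simp only: real_norm_def abs_norm_cancel\<close>)
  have s2: "summable (\<lambda>k. (norm (q ^ Suc k * p (Suc k)))\<^sup>2)"
    by (rule summable_comparison_test' [OF sums_summable [OF S2], of 0])
      (use sq in \<open>simp only: real_norm_def abs_power2\<close>)
  have s0: "summable (\<lambda>k. norm (q ^ k * p k))"
    using s1 by (subst summable_Suc_iff [symmetric])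
  have "(\<Sum>k. norm (q ^ k * p k)) = a + (\<Sum>k. norm (q ^ Suc k * p (Suc k)))"
    using suminf_split_head [OF s0] a by simp
  also have "\<dots> \<le> a + 2 * (1 - a) * (r / (1 - r))"
    using suminf_le [OF coeff_term s1 sums_summable [OF S1]] S1 by (simp only: sums_iff)
  finally have b1: "(\<Sum>k. norm (q ^ k * p k)) \<le> a + 2 * (1 - a) * (r / (1 - r))" .
  have r2: "r\<^sup>2 < 1"
    using r by (simp add: power_less_one_iff)
  have b2: "(\<Sum>k. (norm (q ^ Suc k * p (Suc k)))\<^sup>2) \<le> (1 - a) * (4 * (r\<^sup>2 / (1 - r\<^sup>2)))"
  proof -
    have "(\<Sum>k. (norm (q ^ Suc k * p (Suc k)))\<^sup>2) \<le> (2 * (1 - a))\<^sup>2 * (r\<^sup>2 / (1 - r\<^sup>2))"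
      using suminf_le [OF sq s2 sums_summable [OF S2]] S2 by (simp only: sums_iff)
    \<comment> \<open>Of the square of \<open>1 - a\<close>, one factor is kept, to match the factor
      in the first sum, and the other is bounded by 1.\<close>
    also have "\<dots> = (1 - a) * ((1 - a) * (4 * (r\<^sup>2 / (1 - r\<^sup>2))))"
      unfolding power_mult_distrib by (simp add: power2_eq_square [of "1 - a"])
    also have "\<dots> \<le> (1 - a) * (1 * (4 * (r\<^sup>2 / (1 - r\<^sup>2))))"
      using a r r2 by (intro mult_left_mono mult_right_mono) auto
    finally show ?thesis by simp
  qed
  \<comment> \<open>Since \<open>a \<ge> 0\<close>, the weight \<open>1 / (1 + a)\<close> is at most
    1, its value at \<open>a = 0\<close>.\<close>
  have "(1 / (1 + a) + r / (1 - r)) * (\<Sum>k. (norm (q ^ Suc k * p (Suc k)))\<^sup>2)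
      \<le> (1 + r / (1 - r)) * ((1 - a) * (4 * (r\<^sup>2 / (1 - r\<^sup>2))))"
    using a r b2 by (intro mult_mono add_mono suminf_nonneg s2) auto
  then have "bohr_sum p q \<le> a + 2 * (1 - a) * (r / (1 - r))
      + (1 + r / (1 - r)) * ((1 - a) * (4 * (r\<^sup>2 / (1 - r\<^sup>2))))"
    unfolding bohr_sum_def using b1 a by (simp add: r_def of_real_def)
  also have "\<dots> = 1 + (1 - a) *
      (2 * (r / (1 - r)) + (1 + r / (1 - r)) * (4 * (r\<^sup>2 / (1 - r\<^sup>2))) - 1)"
    by (simp only: algebra_simps)
  also have "\<dots> \<le> 1"
  proof -
    have "- (3 * r ^ 3 - 5 * r ^ 2 - 3 * r + 1) / ((1 - r) * (1 - r\<^sup>2)) \<le> 0"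
      using poly r r2 unfolding r_def [symmetric] by (intro divide_nonpos_pos) auto
    with a have "(1 - a) * (- (3 * r ^ 3 - 5 * r ^ 2 - 3 * r + 1) / ((1 - r) * (1 - r\<^sup>2))) \<le> 0"
      by (intro mult_nonneg_nonpos) simp_all
    then show ?thesis
      unfolding bohr_poly_identity [OF r] by linarith
  qed
  finally show ?thesis
    using s0 s2 by (simp only: bohr_summable_def)
qed

section \<open>The extremal function\<close>

definition extremal :: "quat \<Rightarrow> quat" where
  "extremal q = 2 - 2 * inverse (1 - q)"

definition extremal_coeff :: "nat \<Rightarrow> quat" where
  "extremal_coeff k = (if k = 0 then 0 else - 2)"

text \<open>Without commutativity the derivative of an inverse keeps the inner derivative
  \<open>g'\<close> between two inverses. Both coordinate lines of a slice are instances of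
  \<open>g\<close>.\<close>

lemma extremal_has_vector_derivative:
  assumes "(g has_vector_derivative g') (at t)" "1 - g t \<noteq> 0"
  shows "((\<lambda>t. extremal (g t)) has_vector_derivative
    - 2 * (inverse (1 - g t) * g' * inverse (1 - g t))) (at t)"
proof -
  have "((\<lambda>t. 1 - g t) has_derivative (\<lambda>h. 0 - h *\<^sub>R g')) (at t)"
    using assms(1) unfolding has_vector_derivative_def by (intro has_derivative_diff has_derivative_const)
  from Deriv.has_derivative_inverse [OF assms(2) this]
  have "((\<lambda>t. 2 - 2 * inverse (1 - g t)) has_derivative (\<lambda>h. 0 - 2 *
      - (inverse (1 - g t) * (0 - h *\<^sub>R g') * inverse (1 - g t)))) (at t)"
    by (intro has_derivative_diff has_derivative_const has_derivative_mult_right)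
  then show ?thesis
    unfolding has_vector_derivative_def extremal_def by simp
qed

text \<open>Within its slice, \<open>I\<close> commutes with the inverse \<open>J z\<close>. Hence
  the y-derivative is \<open>I\<close> times the x-derivative, and \<open>I * I = - 1\<close> gives
  the Cauchy-Riemann equation.\<close>

lemma extremal_slice_regular: "slice_regular extremal"
  unfolding slice_regular_def
proof
  fix I assume "I \<in> imag_units"
  then have I: "I * I = - 1"
    by (simp add: imag_units_def power2_eq_square)
  define J where "J z = inverse (1 - (of_real (fst z) + snd z *\<^sub>R I))" for z :: "real \<times> real"
  have ne: "1 - (of_real (fst z) + snd z *\<^sub>R I) \<noteq> 0" if "z \<in> slice_disc I" for z
  proof
    assume "1 - (of_real (fst z) + snd z *\<^sub>R I) = 0"
    then have "of_real (fst z) + snd z *\<^sub>R I = 1"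
      by simp
    then show False
      using that by (cases z) (auto simp: slice_disc_def)
  qed
  have contJ: "continuous_on (slice_disc I) J"
    unfolding J_def by (intro continuous_intros) (use ne in auto)
  let ?fx = "\<lambda>z. - 2 * (J z * J z)" and ?fy = "\<lambda>z. - 2 * (J z * I * J z)"
  have comm: "I * J z = J z * I" if "z \<in> slice_disc I" for z
  proof -
    let ?w = "1 - (of_real (fst z) + snd z *\<^sub>R I)"
    \<comment> \<open>Multiplying this by \<open>inverse ?w\<close> on both sides transfers
      commutation from \<open>?w\<close> to its inverse.\<close>
    have "?w * I = I * ?w"
      by (simp add: algebra_simps of_real_def)
    then have "inverse ?w * (?w * I) * inverse ?w = inverse ?w * (I * ?w) * inverse ?w"
      by simp
    moreover have "inverse ?w * (?w * I) = I"
      using ne [OF that] by (simp flip: mult.assoc)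
    moreover have "inverse ?w * (I * ?w) * inverse ?w = inverse ?w * I"
      using ne [OF that] by (simp add: mult.assoc)
    ultimately show ?thesis
      by (simp only: J_def)
  qed
  show "\<exists>fx fy :: real \<times> real \<Rightarrow> quat.
     continuous_on (slice_disc I) fx \<and> continuous_on (slice_disc I) fy \<and>
     (\<forall>(x, y)\<in>slice_disc I.
        ((\<lambda>t. extremal (of_real t + y *\<^sub>R I)) has_vector_derivative fx (x, y)) (at x) \<and>
        ((\<lambda>t. extremal (of_real x + t *\<^sub>R I)) has_vector_derivative fy (x, y)) (at y) \<and>
        (1/2) *\<^sub>R (fx (x, y) + I * fy (x, y)) = 0)"
  proof (intro exI conjI ballI)
    show "continuous_on (slice_disc I) ?fx" "continuous_on (slice_disc I) ?fy"
      by (intro continuous_intros contJ)+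
    fix z assume z: "z \<in> slice_disc I"
    obtain x y where xy: "z = (x, y)"
      by (cases z)
    have nxy: "1 - (of_real x + y *\<^sub>R I) \<noteq> 0"
      using ne [OF z] by (simp add: xy)
    have "((\<lambda>t. of_real t + y *\<^sub>R I) has_vector_derivative 1) (at x)"
      unfolding of_real_def by (auto intro!: derivative_eq_intros)
    then have "((\<lambda>t. extremal (of_real t + y *\<^sub>R I)) has_vector_derivative ?fx (x, y)) (at x)"
      using extremal_has_vector_derivative nxy unfolding J_def fst_conv snd_conv by fastforce
    moreover have "((\<lambda>t. of_real x + t *\<^sub>R I) has_vector_derivative I) (at y)"
      by (auto intro!: derivative_eq_intros)
    then have "((\<lambda>t. extremal (of_real x + t *\<^sub>R I)) has_vector_derivative ?fy (x, y)) (at y)"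
      using extremal_has_vector_derivative nxy unfolding J_def fst_conv snd_conv by fastforce
    moreover have "(1/2) *\<^sub>R (?fx (x, y) + I * ?fy (x, y)) = 0"
    proof -
      have "I * (J z * I * J z) = (I * I) * (J z * J z)"
        by (simp only: comm [OF z, symmetric] mult.assoc)
      then have "I * (J z * I * J z) = - (J z * J z)"
        using I by simp
      then show ?thesis
        unfolding xy by (simp add: algebra_simps mult_2 mult_2_right)
    qed
    ultimately show "case z of (x, y) \<Rightarrow>
        ((\<lambda>t. extremal (of_real t + y *\<^sub>R I)) has_vector_derivative ?fx (x, y)) (at x) \<and>
        ((\<lambda>t. extremal (of_real x + t *\<^sub>R I)) has_vector_derivative ?fy (x, y)) (at y) \<and>
        (1/2) *\<^sub>R (?fx (x, y) + I * ?fy (x, y)) = 0"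
      by (simp add: xy)
  qed
qed

text \<open>The sum S satisfies S - 1 = q S, so it is a right inverse of 1 - q, and in a division
  algebra that makes it the inverse.\<close>

lemma geometric_sums_div_algebra:
  fixes q :: "'a :: {real_normed_div_algebra, banach}"
  assumes "norm q < 1"
  shows "(\<lambda>k. q ^ k) sums inverse (1 - q)"
proof -
  have ne: "1 - q \<noteq> 0"
    using assms by auto
  have s: "summable (\<lambda>k. q ^ k)"
    by (rule summable_norm_cancel) (use assms in \<open>simp add: norm_power summable_geometric\<close>)
  have "(\<Sum>k. q ^ k) - 1 = q * (\<Sum>k. q ^ k)"
    using suminf_split_head [OF s] suminf_mult [OF s, of q] by simp
  then have "(1 - q) * (\<Sum>k. q ^ k) = 1"
    by (simp add: algebra_simps)
  then have "(\<Sum>k. q ^ k) = inverse (1 - q)"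
    using inverse_unique by metis
  then show ?thesis
    using s by (metis summable_sums)
qed

lemma extremal_sums:
  assumes "norm q < 1"
  shows "(\<lambda>k. q ^ k * extremal_coeff k) sums extremal q"
proof -
  have "(\<lambda>k. (if k = 0 then 2 else 0) - 2 * q ^ k) sums (2 - 2 * inverse (1 - q))"
    by (intro sums_diff sums_mult geometric_sums_div_algebra assms sums_If_finite_set' sums_single)
  moreover have "(if k = 0 then 2 else 0) - 2 * q ^ k = q ^ k * extremal_coeff k" for k
    by (simp add: extremal_coeff_def mult_2 mult_2_right)
  ultimately show ?thesis
    by (simp add: extremal_def)
qed

text \<open>With w = 1 - q, |w|^2 = 1 - 2 Re q + |q|^2 <= 2 Re w, so the real part of the inverse of
  w, which is Re w / |w|^2, is at least 1/2.\<close>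

lemma extremal_half_space:
  assumes "norm q < 1"
  shows "qRe (extremal q) \<le> 1"
proof -
  let ?w = "1 - q"
  have "?w \<noteq> 0"
    using assms by auto
  then have pos: "(norm ?w)\<^sup>2 > 0"
    by simp
  have "(norm q)\<^sup>2 \<le> 1"
    using assms by (simp add: power_le_one)
  then have "(norm ?w)\<^sup>2 \<le> 2 * qRe ?w"
    unfolding quat_norm_sq by (simp add: power2_eq_square algebra_simps)
  then have "1 \<le> 2 * (qRe ?w / (norm ?w)\<^sup>2)"
    using pos by (simp add: divide_simps)
  moreover have "extremal q = 2 *\<^sub>R (1 - inverse ?w)"
    by (simp add: extremal_def scaleR_conv_of_real algebra_simps)
  ultimately show ?thesis
    by (simp add: inverse_quat_def divide_inverse mult.commute)
qed

lemma extremal_bohr_class: "bohr_class extremal extremal_coeff"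
  unfolding bohr_class_def half_space_def
  using extremal_slice_regular extremal_sums extremal_half_space
  by (auto simp: extremal_coeff_def intro!: image_eqI [where x = 0])

lemma extremal_bohr_sum:
  fixes r :: real
  assumes "0 \<le> r" "r < 1"
  shows "bohr_summable extremal_coeff (of_real r)"
    and "bohr_sum extremal_coeff (of_real r) =
      2 * (r / (1 - r)) + (1 + r / (1 - r)) * (4 * (r\<^sup>2 / (1 - r\<^sup>2)))"
proof -
  have t: "norm ((of_real r :: quat) ^ Suc k * extremal_coeff (Suc k)) = 2 * r ^ Suc k" for k
    using assms by (simp add: extremal_coeff_def norm_mult norm_power)
  have "(\<lambda>k. norm ((of_real r :: quat) ^ Suc k * extremal_coeff (Suc k))) sums (2 * (r / (1 - r)))"
    unfolding t by (intro sums_mult geometric_Suc_sums assms)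
  then have s1: "(\<lambda>k. norm ((of_real r :: quat) ^ k * extremal_coeff k)) sums (2 * (r / (1 - r)))"
    by (subst (asm) sums_Suc_iff) (simp add: extremal_coeff_def)
  have "(\<lambda>k. 2\<^sup>2 * (r ^ Suc k)\<^sup>2) sums (2\<^sup>2 * (r\<^sup>2 / (1 - r\<^sup>2)))"
    by (intro sums_mult geometric_square_Suc_sums assms)
  then have s2: "(\<lambda>k. (norm ((of_real r :: quat) ^ Suc k * extremal_coeff (Suc k)))\<^sup>2)
      sums (4 * (r\<^sup>2 / (1 - r\<^sup>2)))"
    unfolding t power_mult_distrib by simp
  show "bohr_summable extremal_coeff (of_real r)"
    unfolding bohr_summable_def using s1 s2 by (simp only: sums_iff)
  show "bohr_sum extremal_coeff (of_real r) =
      2 * (r / (1 - r)) + (1 + r / (1 - r)) * (4 * (r\<^sup>2 / (1 - r\<^sup>2)))"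
    unfolding bohr_sum_def sums_unique [OF s1, symmetric] sums_unique [OF s2, symmetric]
    using assms by (simp add: extremal_coeff_def)
qed

section \<open>Location of the root and sharpness\<close>

theorem theorem1p7:
  shows "\<exists>R :: real.
    {r :: real. 0 < r \<and> r < 1 \<and> 3 * r ^ 3 - 5 * r ^ 2 - 3 * r + 1 = 0} = {R} \<and>
    \<bar>R - 0.24683\<bar> < 0.000005 \<and>
    (\<forall>f p q. bohr_class f p \<and> norm q \<le> R \<longrightarrow> bohr_summable p q \<and> bohr_sum p q \<le> 1) \<and>
    (\<forall>R' > R. \<exists>f p q. bohr_class f p \<and> norm q < 1 \<and> norm q \<le> R' \<and>
       bohr_summable p q \<and> bohr_sum p q > 1)"
proof -
  define P :: "real \<Rightarrow> real" where "P r = 3 * r ^ 3 - 5 * r ^ 2 - 3 * r + 1" for r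
  have mono: "P y < P x" if "0 \<le> x" "x < y" "y \<le> 1" for x y
    unfolding P_def using that by (rule bohr_poly_strict_antimono)
  \<comment> \<open>The cubic changes sign between these endpoints, and both lie within 0.000004 of
    0.24683.\<close>
  have "\<exists>R\<ge>0.246826. R \<le> 0.246834 \<and> P R = 0"
    by (rule IVT2') (auto simp: P_def power2_eq_square power3_eq_cube intro!: continuous_intros)
  then obtain R where R: "0.246826 \<le> R" "R \<le> 0.246834" "P R = 0"
    by blast
  have R01: "0 < R" "R < 1/2"
    using R by simp_all
  have "{r. 0 < r \<and> r < 1 \<and> P r = 0} = {R}"
  proof (intro equalityI subsetI)
    fix r assume "r \<in> {r. 0 < r \<and> r < 1 \<and> P r = 0}"
    then show "r \<in> {R}"
      using mono [of r R] mono [of R r] R R01 by (cases r R rule: linorder_cases) auto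
  qed (use R R01 in auto)
  moreover have "\<bar>R - 0.24683\<bar> < 0.000005"
    unfolding abs_less_iff using R by simp
  moreover have "bohr_summable p q \<and> bohr_sum p q \<le> 1" if "bohr_class f p" "norm q \<le> R" for f p q
  proof (rule bohr_inequality [OF that(1)])
    show "norm q < 1"
      using that R01 by linarith
    have "P (norm q) \<ge> 0"
      using mono [of "norm q" R] that R R01 by (cases "norm q = R") auto
    then show "3 * norm q ^ 3 - 5 * norm q ^ 2 - 3 * norm q + 1 \<ge> 0"
      by (simp add: P_def)
  qed
  moreover have "\<exists>f p q. bohr_class f p \<and> norm q < 1 \<and> norm q \<le> R' \<and>
       bohr_summable p q \<and> bohr_sum p q > 1" if "R' > R" for R'
  proof -
    \<comment> \<open>\<open>R'\<close> may be 1 or more; capping at 1/2 keeps the test point in the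
      ball and still beyond \<open>R\<close>, as \<open>R < 1/2\<close>.\<close>
    define r where "r = min R' (1/2)"
    have r: "0 \<le> r" "r < 1" "R < r" "r \<le> R'"
      using R01 that by (auto simp: r_def)
    have "r\<^sup>2 < 1"
      using r by (simp add: power_less_one_iff)
    moreover have "P r < 0"
      using mono [of R r] R R01 r by simp
    ultimately have "- P r / ((1 - r) * (1 - r\<^sup>2)) > 0"
      using r by (intro divide_pos_pos mult_pos_pos) auto
    then have "bohr_sum extremal_coeff (of_real r) > 1"
      using bohr_poly_identity [OF r(1,2)] extremal_bohr_sum(2) [OF r(1,2)] by (simp add: P_def)
    then show ?thesis
      using extremal_bohr_class extremal_bohr_sum(1) [OF r(1,2)] r
      by (intro exI [of _ extremal] exI [of _ extremal_coeff] exI [of _ "of_real r"]) simp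
  qed
  ultimately show ?thesis
    unfolding P_def by (intro exI [of _ R]) blast
qed

end
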